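(* Let $G$ be a locally finite group and let $V$ be a finite-dimensional vector space over an arbitrary field $\mathbb{K}$. Let $\tau \colon V^G \to V^G$ be a linear cellular automaton. Then $\tau$ is surjective if and only if it is injective.
   Context: A group is called locally finite if all its finitely generated subgroups are finite. Let $G$ be a group and $A$ a set. $A^G$ denotes the set of all maps $x \colon G \to A$ (configurations). The group $G$ acts on $A^G$ by $(gx)(h) = x(g^{-1}h)$ for all $x \in A^G$ and $g,h \in G$. A cellular automaton over the group $G$ and the alphabet $A$ is a map $\tau \colon A^G \to A^G$ for which there exist a finite subset $M \subset G$ (a memory set) and a map $\mu \colon A^M \to A$ (a local defining map) such that $\tau(x)(g) = \mu((g^{-1}x)|_M)$ for all $x \in A^G$ and $g \in G$, where $(\cdot)|_M \colon A^G \to A^M$ is the restriction map. If $V$ is a vector space over a field $\mathbb{K}$, a cellular automaton $\tau \colon V^G \to V^G$ is called a linear cellular automaton if $\tau$ is $\mathbb{K}$-linear with respect to the product (pointwise) vector space structure on $V^G$. *)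

theory Defs
  imports Complex_Main "HOL-Algebra.Generated_Groups" "HOL-Library.FuncSet"
begin

definition locally_finite_group :: "('g, 'm) monoid_scheme \<Rightarrow> bool" where
  "locally_finite_group G \<longleftrightarrow> group G \<and>
     (\<forall>H. subgroup H G \<and> (\<exists>S. finite S \<and> S \<subseteq> carrier G \<and> H = generate G S) \<longrightarrow> finite H)"

(* Maps on the carrier are represented extensionally (value undefined off the carrier),
   so that equality of HOL functions is equality of configurations. *)
definition configs :: "('g, 'm) monoid_scheme \<Rightarrow> 'a set \<Rightarrow> ('g \<Rightarrow> 'a) set" where
  "configs G A = (carrier G \<rightarrow>\<^sub>E A)"

definition shift :: "('g, 'm) monoid_scheme \<Rightarrow> 'g \<Rightarrow> ('g \<Rightarrow> 'a) \<Rightarrow> ('g \<Rightarrow> 'a)" where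
  "shift G g x = (\<lambda>h\<in>carrier G. x (inv\<^bsub>G\<^esub> g \<otimes>\<^bsub>G\<^esub> h))"

definition cellular_automaton ::
    "('g, 'm) monoid_scheme \<Rightarrow> 'a set \<Rightarrow> (('g \<Rightarrow> 'a) \<Rightarrow> ('g \<Rightarrow> 'a)) \<Rightarrow> bool" where
  "cellular_automaton G A \<tau> \<longleftrightarrow>
     \<tau> \<in> configs G A \<rightarrow> configs G A \<and>
     (\<exists>M \<mu>. finite M \<and> M \<subseteq> carrier G \<and> \<mu> \<in> (M \<rightarrow>\<^sub>E A) \<rightarrow> A \<and>
        (\<forall>x\<in>configs G A. \<forall>g\<in>carrier G.
           \<tau> x g = \<mu> (restrict (shift G (inv\<^bsub>G\<^esub> g) x) M)))"

definition config_add ::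
    "('g, 'm) monoid_scheme \<Rightarrow> ('g \<Rightarrow> 'v::ab_group_add) \<Rightarrow> ('g \<Rightarrow> 'v) \<Rightarrow> ('g \<Rightarrow> 'v)" where
  "config_add G x y = (\<lambda>g\<in>carrier G. x g + y g)"

definition config_scale ::
    "('g, 'm) monoid_scheme \<Rightarrow> ('k \<Rightarrow> 'v \<Rightarrow> 'v) \<Rightarrow> 'k \<Rightarrow> ('g \<Rightarrow> 'v) \<Rightarrow> ('g \<Rightarrow> 'v)" where
  "config_scale G scale c x = (\<lambda>g\<in>carrier G. scale c (x g))"

(* The alphabet is a whole type 'v, with scalar multiplication scale as in the locale
   vector_space; linearity is only required on configurations. *)
definition linear_cellular_automaton ::
    "('g, 'm) monoid_scheme \<Rightarrow> ('k::field \<Rightarrow> 'v::ab_group_add \<Rightarrow> 'v) \<Rightarrow>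
     (('g \<Rightarrow> 'v) \<Rightarrow> ('g \<Rightarrow> 'v)) \<Rightarrow> bool" where
  "linear_cellular_automaton G scale \<tau> \<longleftrightarrow>
     cellular_automaton G UNIV \<tau> \<and>
     (\<forall>x\<in>configs G UNIV. \<forall>y\<in>configs G UNIV.
        \<tau> (config_add G x y) = config_add G (\<tau> x) (\<tau> y)) \<and>
     (\<forall>c. \<forall>x\<in>configs G UNIV.
        \<tau> (config_scale G scale c x) = config_scale G scale c (\<tau> x))"

end

theory Submission
  imports Defs "HOL-Library.Function_Algebras"
begin

text \<open>
  The subgroup \<open>H\<close> generated by a memory set is finite, and the automaton acts on each left coset of
  \<open>H\<close> separately, in each case as a copy of one linear endomorphism of the finite-dimensional
  space \<open>V\<^sup>H\<close>. Hence the automaton is injective (surjective) if and only if this endomorphism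
  is, and for the endomorphism the two properties agree by dimension.
\<close>

subsection \<open>Endomorphisms of finite-dimensional subspaces\<close>

text \<open>Both directions count the images of a basis \<open>B\<close> of \<open>W\<close>, which
  is finite by the exchange lemma. The ambient space may be infinite-dimensional, as the space of
  all functions on the group type can be.\<close>

lemma (in vector_space) inj_on_iff_surj_finite_span:
  assumes W: "subspace W" "W \<subseteq> span T" "finite T"
    and f: "Vector_Spaces.linear scale scale f" and fW: "f ` W \<subseteq> W"
  shows "f ` W = W \<longleftrightarrow> inj_on f W"
proof -
  interpret vector_space_pair scale scale ..
  obtain B where B: "B \<subseteq> W" "independent B" "W \<subseteq> span B"
    using maximal_independent_subset[of W] by blast
  have WB: "W = span B"
    using B W(1) span_minimal by blast
  have finB: "finite B"
    using independent_span_bound[OF W(3) B(2)] B(1) W(2) by blast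
  have image: "f ` W = span (f ` B)"
    unfolding WB using linear_span_image[OF f] by simp
  show ?thesis
  proof
    assume inj: "inj_on f W"
    then have card: "card (f ` B) = card B"
      using B(1) by (meson card_image inj_on_subset)
    have ind: "independent (f ` B)"
      using linear_independent_injective_image[OF f B(2)] inj WB by simp
    \<comment> \<open>The image of \<open>B\<close> is independent and has \<open>card B\<close>
      elements; a vector of \<open>W\<close> outside its span would give \<open>card B + 1\<close>
      independent vectors in \<open>span B\<close>.\<close>
    have "v \<in> span (f ` B)" if "v \<in> W" for v
    proof (rule ccontr)
      assume v: "v \<notin> span (f ` B)"
      then have "independent (insert v (f ` B))"
        using ind independent_insertI by blast
      moreover have "insert v (f ` B) \<subseteq> span B"
        using that fW B(1) WB by blast
      ultimately have "card (insert v (f ` B)) \<le> card B"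
        using independent_span_bound[OF finB] by blast
      moreover have "v \<notin> f ` B"
        using v span_base by blast
      ultimately show False
        using finB card by simp
    qed
    then show "f ` W = W"
      using fW image by blast
  next
    assume surj: "f ` W = W"
    then have BS: "B \<subseteq> span (f ` B)"
      using B(1) image by simp
    \<comment> \<open>A basis \<open>C\<close> chosen inside the image of \<open>B\<close> spans
      \<open>W\<close>, so \<open>card B \<le> card C\<close>. This forces \<open>C\<close> to be
      the whole image and \<open>f\<close> to be injective on \<open>B\<close>.\<close>
    obtain C where C: "C \<subseteq> f ` B" "independent C" "f ` B \<subseteq> span C"
      using maximal_independent_subset[of "f ` B"] by blast
    have finC: "finite C"
      using C(1) finB finite_subset by blast
    have "B \<subseteq> span C"
      using BS C(3) span_minimal[OF _ subspace_span] by blast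
    then have "card B \<le> card C"
      using independent_span_bound[OF finC B(2)] by blast
    moreover have "card C \<le> card (f ` B)" "card (f ` B) \<le> card B"
      using C(1) finB by (simp_all add: card_mono card_image_le)
    ultimately have "C = f ` B" "inj_on f B"
      using C(1) finB by (simp_all add: card_subset_eq eq_card_imp_inj_on)
    then show "inj_on f W"
      using linear_inj_on_span_independent_image[OF f] C(2) WB by simp
  qed
qed

text \<open>This models \<open>V\<^sup>H\<close> by functions that are zero, not
  \<open>undefined\<close>, off \<open>H\<close>: they form a subspace of the full function
  space.\<close>

definition supported_on :: "'g set \<Rightarrow> ('g \<Rightarrow> 'v::zero) set" where
  "supported_on H = {x. \<forall>g. g \<notin> H \<longrightarrow> x g = 0}"

lemma (in vector_space) vector_space_fun: "vector_space (\<lambda>c x g. c *s x g)"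
  by unfold_locales (auto simp: fun_eq_iff scale_right_distrib scale_left_distrib)

text \<open>The spanning set consists of the functions concentrated at one point of \<open>H\<close>
  with a basis vector as value.\<close>

lemma (in finite_dimensional_vector_space) supported_on_finite_span:
  fixes H :: "'g set"
  assumes "finite H"
  shows "\<exists>T. finite T \<and> supported_on H \<subseteq> module.span (\<lambda>c x g. c *s x g) T"
proof -
  interpret F: vector_space "\<lambda>c (x::'g \<Rightarrow> 'b) g. c *s x g"
    by (rule vector_space_fun)
  define e where "e = (\<lambda>(h::'g) v g. if g = h then v else (0::'b))"
  define T where "T = (\<lambda>(h, b). e h b) ` (H \<times> Basis)"
  have e_span: "e h v \<in> F.span T" if "h \<in> H" for h v
  proof -
    have lin: "Vector_Spaces.linear scale (\<lambda>c x g. c *s x g) (e h)"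
      unfolding Vector_Spaces.linear_iff
      by (auto simp: e_def fun_eq_iff vector_space_axioms F.vector_space_axioms)
    interpret P: vector_space_pair scale "\<lambda>c (x::'g \<Rightarrow> 'b) g. c *s x g"
      by (intro vector_space_pair.intro vector_space_axioms F.vector_space_axioms)
    have "e h v \<in> e h ` span Basis"
      by (simp add: span_Basis)
    also have "\<dots> = F.span (e h ` Basis)"
      using P.linear_span_image[OF lin] by simp
    also have "\<dots> \<subseteq> F.span T"
      using that by (intro F.span_mono) (auto simp: T_def)
    finally show ?thesis .
  qed
  have "x \<in> F.span T" if "x \<in> supported_on H" for x
  proof -
    have "(\<Sum>h\<in>H. e h (x h)) g = x g" for g
    proof -
      have "(\<Sum>h\<in>A. e h (x h)) g = (\<Sum>h\<in>A. e h (x h) g)" if "finite A" for A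
        using that by (induction A) auto
      \<comment> \<open>At a point of \<open>H\<close> a single summand survives; elsewhere every
        summand vanishes, and so does \<open>x\<close>.\<close>
      then show ?thesis
        using assms that by (simp add: e_def supported_on_def)
    qed
    then have "x = (\<Sum>h\<in>H. e h (x h))"
      by auto
    then show ?thesis
      using e_span F.span_sum[of H "\<lambda>h. e h (x h)" T] by simp
  qed
  moreover have "finite T"
    using assms finite_Basis by (simp add: T_def)
  ultimately show ?thesis
    by blast
qed

subsection \<open>The action of an automaton on a finite subgroup\<close>

text \<open>The inner restriction turns a total function into a configuration; the cut-off to zero
  puts the result back into \<open>supported_on H\<close>.\<close>

definition ca_on ::
    "('g, 'm) monoid_scheme \<Rightarrow> 'g set \<Rightarrow> (('g \<Rightarrow> 'v) \<Rightarrow> ('g \<Rightarrow> 'v)) \<Rightarrow> ('g \<Rightarrow> 'v) \<Rightarrow> ('g \<Rightarrow> 'v::zero)" where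
  "ca_on G H \<tau> x = (\<lambda>g. if g \<in> H then \<tau> (restrict x (carrier G)) g else 0)"

lemma ca_on_supported: "ca_on G H \<tau> x \<in> supported_on H"
  by (simp add: ca_on_def supported_on_def)

lemma restrict_configs [simp]: "restrict x (carrier G) \<in> configs G UNIV"
  by (simp add: configs_def)

lemma configs_eqI:
  assumes "x \<in> configs G A" "y \<in> configs G A" "\<And>g. g \<in> carrier G \<Longrightarrow> x g = y g"
  shows "x = y"
  using assms unfolding configs_def by (rule PiE_ext)

text \<open>Restriction to the carrier turns pointwise operations into \<open>config_add\<close> and
  \<open>config_scale\<close>, so linearity of \<open>\<tau>\<close> carries over. As
  \<open>H\<close> lies in the carrier, these are again pointwise on \<open>H\<close>.\<close>

lemma linear_ca_on:
  assumes vs: "vector_space scale" and lin: "linear_cellular_automaton G scale \<tau>"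
    and H: "H \<subseteq> carrier G"
  shows "Vector_Spaces.linear (\<lambda>c x g. scale c (x g)) (\<lambda>c x g. scale c (x g)) (ca_on G H \<tau>)"
proof -
  interpret vector_space scale by fact
  have add: "\<tau> (restrict (x + y) (carrier G)) =
      config_add G (\<tau> (restrict x (carrier G))) (\<tau> (restrict y (carrier G)))" for x y
  proof -
    have "restrict (x + y) (carrier G) =
        config_add G (restrict x (carrier G)) (restrict y (carrier G))"
      by (auto simp: config_add_def)
    then show ?thesis
      using lin by (simp add: linear_cellular_automaton_def)
  qed
  have scale: "\<tau> (restrict (\<lambda>g. scale c (x g)) (carrier G)) =
      config_scale G scale c (\<tau> (restrict x (carrier G)))" for c x
  proof -
    have "restrict (\<lambda>g. scale c (x g)) (carrier G) =
        config_scale G scale c (restrict x (carrier G))"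
      by (auto simp: config_scale_def)
    then show ?thesis
      using lin by (simp add: linear_cellular_automaton_def)
  qed
  show ?thesis
    unfolding Vector_Spaces.linear_iff ca_on_def add scale
    using H by (auto simp: fun_eq_iff vector_space_fun config_add_def config_scale_def)
qed

text \<open>The value at \<open>a\<close> is the local map applied to the pattern sending
  \<open>m\<close> to \<open>x (a \<otimes> m)\<close>. Allowing two base points \<open>a\<close>
  and \<open>b\<close> captures locality and equivariance in one condition, without the local
  map.\<close>

lemma cellular_automaton_memory:
  assumes "group G" and ca: "cellular_automaton G A \<tau>"
  obtains M where "finite M" "M \<subseteq> carrier G"
    "\<And>x y a b. \<lbrakk>x \<in> configs G A; y \<in> configs G A; a \<in> carrier G; b \<in> carrier G;
       \<And>m. m \<in> M \<Longrightarrow> x (a \<otimes>\<^bsub>G\<^esub> m) = y (b \<otimes>\<^bsub>G\<^esub> m)\<rbrakk> \<Longrightarrow> \<tau> x a = \<tau> y b"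
proof -
  interpret group G by fact
  obtain M \<mu> where M: "finite M" "M \<subseteq> carrier G"
    and \<tau>: "\<forall>x\<in>configs G A. \<forall>g\<in>carrier G. \<tau> x g = \<mu> (restrict (shift G (inv\<^bsub>G\<^esub> g) x) M)"
    using ca unfolding cellular_automaton_def by blast
  have "\<tau> x a = \<tau> y b"
    if "x \<in> configs G A" "y \<in> configs G A" "a \<in> carrier G" "b \<in> carrier G"
      and eq: "\<And>m. m \<in> M \<Longrightarrow> x (a \<otimes>\<^bsub>G\<^esub> m) = y (b \<otimes>\<^bsub>G\<^esub> m)" for x y a b
  proof -
    have "restrict (shift G (inv\<^bsub>G\<^esub> a) x) M = restrict (shift G (inv\<^bsub>G\<^esub> b) y) M"
      using that(3,4) M(2) eq by (intro restrict_ext) (auto simp: shift_def)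
    then show ?thesis
      using \<tau> that(1-4) by simp
  qed
  then show ?thesis
    using that M by blast
qed

section \<open>Transfer between the group and a finite or infinite subgroup containing the
  memory\<close>

context
  fixes G :: "('g, 'm) monoid_scheme" (structure) and H :: "'g set"
    and \<tau> :: "('g \<Rightarrow> 'v::zero) \<Rightarrow> ('g \<Rightarrow> 'v)"
  assumes G: "group G" and H: "subgroup H G"
    and maps: "\<tau> \<in> configs G UNIV \<rightarrow> configs G UNIV"
    and memory: "\<And>x y a b. \<lbrakk>x \<in> configs G UNIV; y \<in> configs G UNIV; a \<in> carrier G; b \<in> carrier G;
       \<And>h. h \<in> H \<Longrightarrow> x (a \<otimes> h) = y (b \<otimes> h)\<rbrakk> \<Longrightarrow> \<tau> x a = \<tau> y b"
begin

interpretation group G by (rule G)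
interpretation H: subgroup H G by (rule H)

text \<open>Since \<open>h \<otimes> k\<close> stays in \<open>H\<close>, the neighbourhoods of
  \<open>h\<close> in \<open>w\<close> and of \<open>a \<otimes> h\<close> in \<open>x\<close> carry
  the same pattern. Thus \<open>ca_on\<close> describes \<open>\<tau>\<close> on every left coset of
  \<open>H\<close>.\<close>

lemma ca_on_translate:
  assumes "x \<in> configs G UNIV" "a \<in> carrier G" "h \<in> H"
    and "\<And>k. k \<in> H \<Longrightarrow> w k = x (a \<otimes> k)"
  shows "ca_on G H \<tau> w h = \<tau> x (a \<otimes> h)"
proof -
  have "\<tau> (restrict w (carrier G)) h = \<tau> x (a \<otimes> h)"
  proof (rule memory)
    show "restrict w (carrier G) (h \<otimes> k) = x (a \<otimes> h \<otimes> k)" if "k \<in> H" for k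
      using assms that by (simp add: m_assoc)
  qed (use assms in simp_all)
  then show ?thesis
    using assms(3) by (simp add: ca_on_def)
qed

lemma inj_on_ca_iff: "inj_on \<tau> (configs G UNIV) \<longleftrightarrow> inj_on (ca_on G H \<tau>) (supported_on H)"
proof
  assume inj: "inj_on \<tau> (configs G UNIV)"
  show "inj_on (ca_on G H \<tau>) (supported_on H)"
  proof (rule inj_onI)
    fix x y assume xy: "x \<in> supported_on H" "y \<in> supported_on H" "ca_on G H \<tau> x = ca_on G H \<tau> y"
    let ?x = "restrict x (carrier G)" and ?y = "restrict y (carrier G)"
    have "\<tau> ?x g = \<tau> ?y g" if g: "g \<in> carrier G" for g
    proof (cases "g \<in> H")
      case True
      then show ?thesis
        using fun_cong[OF xy(3), of g] by (simp add: ca_on_def)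
    next
      case False
      \<comment> \<open>The coset of \<open>g\<close> misses \<open>H\<close>, so both
        configurations are zero on the whole neighbourhood of \<open>g\<close>.\<close>
      then have "g \<otimes> h \<notin> H" if "h \<in> H" for h
        using H.m_closed[OF _ H.m_inv_closed[OF that], of "g \<otimes> h"] that g False
        by (auto simp: m_assoc)
      then show ?thesis
        using xy(1,2) g by (intro memory) (auto simp: supported_on_def)
    qed
    then have "\<tau> ?x = \<tau> ?y"
      using maps by (intro configs_eqI[where G = G and A = UNIV]) auto
    then have eq: "?x = ?y"
      using inj by (simp add: inj_on_eq_iff)
    have "x g = y g" for g
      using fun_cong[OF eq, of g] xy(1,2) by (cases "g \<in> H") (auto simp: supported_on_def)
    then show "x = y" ..
  qed
next
  assume inj: "inj_on (ca_on G H \<tau>) (supported_on H)"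
  show "inj_on \<tau> (configs G UNIV)"
  proof (rule inj_onI)
    fix x y assume xy: "x \<in> configs G UNIV" "y \<in> configs G UNIV" "\<tau> x = \<tau> y"
    show "x = y"
    proof (rule configs_eqI[OF xy(1,2)])
      fix a assume a: "a \<in> carrier G"
      \<comment> \<open>The values of \<open>z\<close> on the coset of \<open>a\<close>, moved to
        \<open>H\<close>; evaluation at the identity recovers \<open>z a\<close>.\<close>
      define w where "w z = (\<lambda>h. if h \<in> H then z (a \<otimes> h) else 0)" for z :: "'g \<Rightarrow> 'v"
      have "ca_on G H \<tau> (w z) h = (if h \<in> H then \<tau> z (a \<otimes> h) else 0)"
        if "z \<in> configs G UNIV" for z h
        using ca_on_translate[OF that a, of h "w z"] by (auto simp: w_def ca_on_def)
      then have "ca_on G H \<tau> (w x) = ca_on G H \<tau> (w y)"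
        using xy by auto
      moreover have "w x \<in> supported_on H" "w y \<in> supported_on H"
        by (auto simp: w_def supported_on_def)
      ultimately have "w x \<one> = w y \<one>"
        using inj by (simp add: inj_on_eq_iff)
      then show "x a = y a"
        using a by (simp add: w_def)
    qed
  qed
qed

text \<open>From left to right, a preimage of the configuration given by \<open>w\<close> is cut off
  outside \<open>H\<close>. Conversely, preimages are chosen on each left coset and glued.\<close>

lemma surj_ca_iff:
  "\<tau> ` configs G UNIV = configs G UNIV \<longleftrightarrow> ca_on G H \<tau> ` supported_on H = supported_on H"
proof
  assume surj: "\<tau> ` configs G UNIV = configs G UNIV"
  have "w \<in> ca_on G H \<tau> ` supported_on H" if w: "w \<in> supported_on H" for w
  proof -
    have "restrict w (carrier G) \<in> \<tau> ` configs G UNIV"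
      using surj by simp
    then obtain x where x: "x \<in> configs G UNIV" "\<tau> x = restrict w (carrier G)"
      by (metis imageE)
    define u where "u = (\<lambda>h. if h \<in> H then x h else 0)"
    have "ca_on G H \<tau> u h = w h" for h
      using ca_on_translate[OF x(1) one_closed, of h u] x(2) w
      by (cases "h \<in> H") (auto simp: u_def ca_on_def supported_on_def)
    then have "w = ca_on G H \<tau> u"
      by auto
    moreover have "u \<in> supported_on H"
      by (simp add: u_def supported_on_def)
    ultimately show ?thesis
      by blast
  qed
  then show "ca_on G H \<tau> ` supported_on H = supported_on H"
    using ca_on_supported by blast
next
  assume surj: "ca_on G H \<tau> ` supported_on H = supported_on H"
  have "y \<in> \<tau> ` configs G UNIV" if y: "y \<in> configs G UNIV" for y
  proof -
    define w where "w a = (\<lambda>h. if h \<in> H then y (a \<otimes> h) else 0)" for a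
    have "\<exists>z. ca_on G H \<tau> z = w a" for a
    proof -
      have "w a \<in> supported_on H"
        by (simp add: w_def supported_on_def)
      then show ?thesis
        using surj by (metis imageE)
    qed
    \<comment> \<open>Only the values of \<open>z a\<close> on \<open>H\<close> will enter the glued
      configuration.\<close>
    then obtain z where z: "ca_on G H \<tau> (z a) = w a" for a
      by metis
    \<comment> \<open>The choice is made from the coset as a set, so all its elements get the same
      representative.\<close>
    define r where "r g = (SOME a. a \<in> g <# H)" for g
    have r: "r g \<in> carrier G" "inv (r g) \<otimes> g \<in> H" if g: "g \<in> carrier G" for g
    proof -
      have "g \<in> g <# H"
        using g H.one_closed by (force simp: l_coset_def)
      then have "r g \<in> g <# H"
        unfolding r_def by (rule someI)
      then obtain h where h: "h \<in> H" "r g = g \<otimes> h"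
        by (auto simp: l_coset_def)
      show "r g \<in> carrier G"
        using h g by simp
      have "inv (r g) \<otimes> g = inv h"
        using h g by (simp add: inv_mult_group m_assoc)
      then show "inv (r g) \<otimes> g \<in> H"
        using h by simp
    qed
    have r_mult: "r (g \<otimes> h) = r g" if "g \<in> carrier G" "h \<in> H" for g h
    proof -
      have "g <# H = (g \<otimes> h) <# H"
        using that H by (intro l_repr_independence) (auto simp: l_coset_def)
      then show ?thesis
        by (simp add: r_def)
    qed
    \<comment> \<open>On the coset with representative \<open>a\<close>, this places a copy of
      \<open>z a\<close>.\<close>
    define x where "x = (\<lambda>g\<in>carrier G. z (r g) (inv (r g) \<otimes> g))"
    have x: "x \<in> configs G UNIV"
      by (simp add: x_def)
    have "\<tau> x g = y g" if g: "g \<in> carrier G" for g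
    proof -
      define a where "a = r g"
      define h where "h = inv a \<otimes> g"
      have a: "a \<in> carrier G" and h: "h \<in> H"
        using r[OF g] by (simp_all add: a_def h_def)
      have gah: "g = a \<otimes> h"
        using a g by (simp add: h_def m_assoc[symmetric])
      \<comment> \<open>A representative represents itself, so \<open>x\<close> on the coset of
        \<open>a\<close> is built from \<open>z a\<close> and from no other preimage.\<close>
      have ra: "r a = a"
        using r_mult[OF a h] by (simp add: gah[symmetric] a_def[symmetric])
      have "z a k = x (a \<otimes> k)" if "k \<in> H" for k
        using that a r_mult[OF a that] ra by (simp add: x_def m_assoc[symmetric])
      then have "\<tau> x g = ca_on G H \<tau> (z a) h"
        using ca_on_translate[OF x a h] gah by simp
      then show ?thesis
        using z h gah by (simp add: w_def)
    qed
    then have "\<tau> x = y"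
      using maps x y by (intro configs_eqI[where G = G and A = UNIV]) auto
    then show ?thesis
      using x by blast
  qed
  then show "\<tau> ` configs G UNIV = configs G UNIV"
    using maps by blast
qed

end

theorem proposition3p1:
  fixes G :: "('g, 'm) monoid_scheme"
    and scale :: "'k::field \<Rightarrow> 'v::ab_group_add \<Rightarrow> 'v"
    and Basis :: "'v set"
    and \<tau> :: "('g \<Rightarrow> 'v) \<Rightarrow> ('g \<Rightarrow> 'v)"
  assumes "locally_finite_group G"
    and "finite_dimensional_vector_space scale Basis"
    and "linear_cellular_automaton G scale \<tau>"
  shows "\<tau> ` configs G UNIV = configs G UNIV \<longleftrightarrow> inj_on \<tau> (configs G UNIV)"
proof -
  interpret group G
    using assms(1) by (simp add: locally_finite_group_def)
  interpret V: finite_dimensional_vector_space scale Basis by fact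
  interpret F: vector_space "\<lambda>c (x::'g \<Rightarrow> 'v) g. scale c (x g)"
    by (rule V.vector_space_fun)
  have ca: "cellular_automaton G UNIV \<tau>"
    using assms(3) by (simp add: linear_cellular_automaton_def)
  obtain M where M: "finite M" "M \<subseteq> carrier G"
    and memory: "\<And>x y a b. \<lbrakk>x \<in> configs G UNIV; y \<in> configs G UNIV; a \<in> carrier G; b \<in> carrier G;
       \<And>m. m \<in> M \<Longrightarrow> x (a \<otimes>\<^bsub>G\<^esub> m) = y (b \<otimes>\<^bsub>G\<^esub> m)\<rbrakk> \<Longrightarrow> \<tau> x a = \<tau> y b"
    by (fact cellular_automaton_memory[OF is_group ca])
  define H where "H = generate G M"
  have H: "subgroup H G"
    unfolding H_def using M(2) by (rule generate_is_subgroup)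
  have finH: "finite H"
    using assms(1) H M unfolding locally_finite_group_def H_def by blast
  have maps: "\<tau> \<in> configs G UNIV \<rightarrow> configs G UNIV"
    using ca by (simp add: cellular_automaton_def)
  \<comment> \<open>Agreement on \<open>H\<close> includes agreement on \<open>M\<close>, so the
    memory may be enlarged to the finite subgroup \<open>H\<close>; neighbourhoods then become left
    cosets.\<close>
  have memory_H: "\<tau> x a = \<tau> y b"
    if "x \<in> configs G UNIV" "y \<in> configs G UNIV" "a \<in> carrier G" "b \<in> carrier G"
      "\<And>h. h \<in> H \<Longrightarrow> x (a \<otimes>\<^bsub>G\<^esub> h) = y (b \<otimes>\<^bsub>G\<^esub> h)" for x y a b
  proof (rule memory)
    show "x (a \<otimes>\<^bsub>G\<^esub> m) = y (b \<otimes>\<^bsub>G\<^esub> m)" if "m \<in> M" for m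
      using \<open>\<And>h. h \<in> H \<Longrightarrow> x (a \<otimes>\<^bsub>G\<^esub> h) = y (b \<otimes>\<^bsub>G\<^esub> h)\<close> generate.incl[OF that, where G = G]
      by (simp add: H_def)
  qed (use that in simp_all)
  have sub: "F.subspace (supported_on H)"
    by (auto simp: F.subspace_def supported_on_def)
  obtain T where T: "finite T" "supported_on H \<subseteq> F.span T"
    using V.supported_on_finite_span[OF finH] by blast
  have lin: "Vector_Spaces.linear (\<lambda>c x g. scale c (x g)) (\<lambda>c x g. scale c (x g)) (ca_on G H \<tau>)"
    using V.vector_space_axioms assms(3) subgroup.subset[OF H] by (rule linear_ca_on)
  have "ca_on G H \<tau> ` supported_on H = supported_on H \<longleftrightarrow>
      inj_on (ca_on G H \<tau>) (supported_on H)"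
    using F.inj_on_iff_surj_finite_span[OF sub T(2,1) lin] ca_on_supported by blast
  moreover have "\<tau> ` configs G UNIV = configs G UNIV \<longleftrightarrow>
      ca_on G H \<tau> ` supported_on H = supported_on H"
    by (rule surj_ca_iff[OF is_group H maps]) (fact memory_H)
  moreover have "inj_on \<tau> (configs G UNIV) \<longleftrightarrow> inj_on (ca_on G H \<tau>) (supported_on H)"
    by (rule inj_on_ca_iff[OF is_group H maps]) (fact memory_H)
  ultimately show ?thesis
    by simp
qed

end
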